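(* Let $k,n\in\mathbb{N}$ satisfy $1\le k\le n-1$. Then $$\frac{B_{n,k}(k/n)}{b_{n,k}(k/n)}<\frac{180451625}{143327232}\,L(n,k,k/n).$$ If in addition $n\le 2k$, then $$\frac{B_{n,k}(k/n)}{b_{n,k}(k/n)}<\sqrt{\frac{\pi}{2}}\,L(n,k,k/n).$$
   Context: $\mathbb{N}$ denotes the positive integers. For integers $0\le k\le n$ and $0<p<1$, $$b_{n,k}(p)=\binom{n}{k}p^k(1-p)^{n-k},\qquad B_{n,k}(p)=\sum_{j=0}^k b_{n,j}(p),$$ and $$L(n,k,p)=\frac{k+1-pn+\sqrt{(pn-k+1)^2+4(1-p)k}}{2}.$$ *)

theory Defs
  imports "HOL-Analysis.Analysis"
begin

text \<open>
  The point probability \<open>b\<^sub>n\<^sub>,\<^sub>k(p)\<close> of the binomial distribution is the library's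
  \<^term>\<open>Bernstein n k p\<close>, i.e. \<open>(n choose k) * p ^ k * (1 - p) ^ (n - k)\<close>.
  It, and the functions below, are meant for \<open>k \<le> n\<close> and \<open>0 < p < 1\<close>.
\<close>

definition binom_cdf :: "nat \<Rightarrow> nat \<Rightarrow> real \<Rightarrow> real" where
  "binom_cdf n k p = (\<Sum>j=0..k. Bernstein n j p)"

definition binom_L :: "nat \<Rightarrow> nat \<Rightarrow> real \<Rightarrow> real" where
  "binom_L n k p =
     (real k + 1 - p * real n + sqrt ((p * real n - real k + 1)\<^sup>2 + 4 * (1 - p) * real k)) / 2"

end

theory Submission
  imports Defs "HOL-Probability.Distributions"
begin

text \<open>
  Write \<open>n = k + q\<close>, \<open>p = k / n\<close> and \<open>\<sigma>\<^sup>2 = k (1 - p)\<close>, so that \<open>L = 1/2 + sqrt (\<sigma>\<^sup>2 + 1/4)\<close>. The quotient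
  \<open>R = B / b\<close> equals the integral of \<open>(1 - u/q)^(q - 1) (1 + u/k)^k\<close> over \<open>0 \<le> u \<le> q\<close>. Substituting
  \<open>exp (- \<sigma>\<^sup>2 z\<^sup>2 / 2) = (1 - u/q)^q (1 + u/k)^k\<close> and bounding \<open>\<sigma>\<^sup>2 z / u\<close> by the quadratic polynomial
  \<open>1 - (1 - 2p)/3 z + b z\<^sup>2\<close> (its Taylor polynomial, up to the choice of \<open>b\<close>) gives
  \<open>R \<le> sqrt (pi/2) (\<sigma> + b/\<sigma>) + (2 - p)/3\<close>, with \<open>b = 1/8\<close> for \<open>p \<ge> 1/2\<close> and \<open>b = 1/12\<close> for \<open>p \<le> 1/2\<close>.
  This settles \<open>p \<ge> 1/2\<close>, and also \<open>p < 1/2\<close> unless \<open>k \<le> 24\<close> and \<open>p < 1/25\<close>.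

  The constant \<open>180451625/143327232\<close> is the value of \<open>R / L\<close> in the Poisson limit \<open>q \<rightarrow> \<infinity>\<close> at \<open>k = 12\<close>, so
  no asymptotic bound can cover the remaining range. There \<open>R\<close> is expanded to second order in \<open>1/q\<close>
  around its Poisson limit \<open>Q\<close>: the coefficients are moments of the summands of \<open>Q\<close> which telescope to
  multiples of \<open>Q\<close> and \<open>1\<close>. This yields \<open>R \<le> s Q + C/2 (1 - s)\<close> with \<open>s = sqrt (1 - p)\<close> and \<open>C\<close> the
  constant above, which reduces the claim to the 24 numerical inequalities
  \<open>Q \<le> C/2 (1 + sqrt (1 + 4k))\<close>.
\<close>

section \<open>Comparison with a Gaussian\<close>

text \<open>
  \<open>k (1 - p) Psi p v\<close> is the rate function at the point \<open>u = k (1 - p) v\<close> of the integrand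
  \<open>(1 - u/q)^q (1 + u/k)^k\<close>; \<open>Psi p v = v\<^sup>2 / 2 + \<dots>\<close> near \<open>0\<close>, and it is meant for \<open>0 \<le> v < 1 / p\<close>.
\<close>

definition Psi :: "real \<Rightarrow> real \<Rightarrow> real" where
  "Psi p v = - ln (1 - p * v) / p - ln (1 + (1 - p) * v) / (1 - p)"

lemma Psi_0 [simp]: "Psi p 0 = 0"
  by (simp add: Psi_def)

lemma has_real_derivative_Psi:
  assumes "0 < p" "p < 1" "0 \<le> v" "p * v < 1"
  shows "(Psi p has_real_derivative v / ((1 - p * v) * (1 + (1 - p) * v))) (at v)"
proof -
  have pos: "1 - p * v > 0" "1 + (1 - p) * v > 0"
    using assms by (auto intro!: add_pos_nonneg mult_nonneg_nonneg)
  have eq: "v / ((1 - p * v) * (1 + (1 - p) * v)) = 1 / (1 - p * v) - 1 / (1 + (1 - p) * v)"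
    using pos by (simp add: field_simps)
  have "((\<lambda>v. ln (1 - p * v)) has_real_derivative - p / (1 - p * v)) (at v)"
       "((\<lambda>v. ln (1 + (1 - p) * v)) has_real_derivative (1 - p) / (1 + (1 - p) * v)) (at v)"
    using pos by (auto intro!: derivative_eq_intros)
  note der = DERIV_diff [OF DERIV_minus [OF DERIV_cdivide [OF this(1), of p]]
                            DERIV_cdivide [OF this(2), of "1 - p"]]
  have "Psi p = (\<lambda>v. - (ln (1 - p * v) / p) - ln (1 + (1 - p) * v) / (1 - p))"
    by (simp add: Psi_def fun_eq_iff)
  with der show ?thesis
    using assms by (simp add: eq)
qed

lemma Psi_strict_mono:
  assumes "0 < p" "p < 1" "0 \<le> u" "u < v" "p * v < 1"
  shows "Psi p u < Psi p v"
proof -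
  have less: "p * x < 1" if "x \<le> v" for x
    using that assms mult_left_mono [of x v p] by linarith
  have pos: "0 < x / ((1 - p * x) * (1 + (1 - p) * x))" if "u < x" "x < v" for x
    using that assms less [of x] by (auto intro!: divide_pos_pos mult_pos_pos add_pos_nonneg)
  show ?thesis
  proof (rule DERIV_pos_imp_increasing_open [OF \<open>u < v\<close>])
    fix x assume x: "u < x" "x < v"
    then show "\<exists>y. DERIV (Psi p) x :> y \<and> y > 0"
      using has_real_derivative_Psi [of p x] pos [OF x] less [of x] assms by force
  next
    show "continuous_on {u..v} (Psi p)"
      using assms less
      by (intro continuous_at_imp_continuous_on ballI DERIV_isCont [OF has_real_derivative_Psi]) auto
  qed
qed

text \<open>
  With \<open>a = (1 - 2 p) / 3\<close> the quotient \<open>z / D z\<close> approximates the inverse function of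
  \<open>v \<mapsto> sqrt (2 Psi p v)\<close> to second order; \<open>key\<close> is the differentiated form of the conclusion.
\<close>

lemma Psi_quotient_le:
  fixes a b p z :: real
  defines "D \<equiv> \<lambda>z. 1 - a * z + b * z\<^sup>2"
  assumes p: "0 < p" "p < 1" and z: "0 \<le> z"
    and above: "\<And>x. 0 \<le> x \<Longrightarrow> p * x < D x"
    and key: "\<And>x. 0 \<le> x \<Longrightarrow> 1 - b * x\<^sup>2 \<le> D x * (D x - p * x) * (D x + (1 - p) * x)"
  shows "Psi p (z / D z) \<le> z\<^sup>2 / 2"
proof -
  define f where "f = (\<lambda>x. x\<^sup>2 / 2 - Psi p (x / D x))"
  have "f 0 \<le> f z"
  proof (rule DERIV_nonneg_imp_nondecreasing [OF z])
    fix x assume "0 \<le> x" "x \<le> z"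
    have D: "p * x < D x" by (rule above) fact
    have "0 \<le> p * x" using p \<open>0 \<le> x\<close> by simp
    with D have Dpos: "D x > 0" by linarith
    have D1: "D x + (1 - p) * x > 0" using Dpos p \<open>0 \<le> x\<close> by (auto intro!: add_pos_nonneg)
    have V: "p * (x / D x) < 1" "0 \<le> x / D x"
      using D Dpos \<open>0 \<le> x\<close> by (auto simp: field_simps)
    have dD: "(D has_real_derivative (- a + 2 * b * x)) (at x)"
      unfolding D_def by (auto intro!: derivative_eq_intros)
    have dV: "((\<lambda>x. x / D x) has_real_derivative ((1 - b * x\<^sup>2) / (D x)\<^sup>2)) (at x)"
      by (rule derivative_eq_intros dD refl | use Dpos in \<open>simp; fail\<close>)+
         (use Dpos in \<open>simp add: D_def power2_eq_square algebra_simps\<close>)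
    have "((\<lambda>x. x\<^sup>2 / 2) has_real_derivative x) (at x)"
      by (auto intro!: derivative_eq_intros)
    from DERIV_diff [OF this DERIV_chain2 [OF has_real_derivative_Psi [OF p V(2,1)] dV]]
    have "(f has_real_derivative x - (x / D x) / ((1 - p * (x / D x)) * (1 + (1 - p) * (x / D x)))
           * ((1 - b * x\<^sup>2) / (D x)\<^sup>2)) (at x)"
      unfolding f_def .
    also have "(x / D x) / ((1 - p * (x / D x)) * (1 + (1 - p) * (x / D x))) * ((1 - b * x\<^sup>2) / (D x)\<^sup>2)
        = x * ((1 - b * x\<^sup>2) / (D x * (D x - p * x) * (D x + (1 - p) * x)))"
    proof -
      have "1 - p * (x / D x) = (D x - p * x) / D x" "1 + (1 - p) * (x / D x) = (D x + (1 - p) * x) / D x"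
        using Dpos by (auto simp: field_simps)
      then show ?thesis
        using Dpos D D1 by (simp add: power2_eq_square)
    qed
    finally have "(f has_real_derivative x - x * ((1 - b * x\<^sup>2) / (D x * (D x - p * x) * (D x + (1 - p) * x)))) (at x)" .
    moreover have "(1 - b * x\<^sup>2) / (D x * (D x - p * x) * (D x + (1 - p) * x)) \<le> 1"
      using key [OF \<open>0 \<le> x\<close>] Dpos D D1 by (subst divide_le_eq_1_pos) auto
    then have "0 \<le> x - x * ((1 - b * x\<^sup>2) / (D x * (D x - p * x) * (D x + (1 - p) * x)))"
      using mult_left_mono [OF _ \<open>0 \<le> x\<close>] by fastforce
    ultimately show "\<exists>y. DERIV f x :> y \<and> y \<ge> 0" by blast
  qed
  then show ?thesis by (simp add: f_def)
qed

text \<open>Were \<open>v < z / D z\<close>, strict monotonicity would give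
  \<open>Psi p v < Psi p (z / D z)\<close>, contradicting \<open>Psi_quotient_le\<close>, whose
  bound is \<open>Psi p v\<close> by the choice of \<open>z\<close>.\<close>

lemma sqrt_Psi_le:
  fixes a b p v :: real
  defines "D \<equiv> \<lambda>z. 1 - a * z + b * z\<^sup>2"
  defines "z \<equiv> sqrt (2 * Psi p v)"
  assumes p: "0 < p" "p < 1" and v: "0 \<le> v" "p * v < 1"
    and above: "\<And>x. 0 \<le> x \<Longrightarrow> p * x < D x"
    and key: "\<And>x. 0 \<le> x \<Longrightarrow> 1 - b * x\<^sup>2 \<le> D x * (D x - p * x) * (D x + (1 - p) * x)"
  shows "z \<le> v * D z"
proof (rule ccontr)
  assume less: "\<not> z \<le> v * D z"
  have Psi: "0 \<le> Psi p v"
    using Psi_strict_mono [of p 0 v] p v by (cases "v = 0") auto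
  then have z: "0 \<le> z" "z\<^sup>2 / 2 = Psi p v" by (auto simp: z_def)
  have D: "p * z < D z" by (rule above) fact
  moreover have "0 \<le> p * z" using p z by simp
  ultimately have Dpos: "0 < D z" by linarith
  have "v < z / D z" "p * (z / D z) < 1" using less Dpos D by (auto simp: field_simps)
  then have "Psi p v < Psi p (z / D z)"
    using p v by (intro Psi_strict_mono)
  also have "\<dots> \<le> z\<^sup>2 / 2"
    unfolding D_def using p z above key by (intro Psi_quotient_le) (auto simp: D_def)
  finally show False using z by simp
qed

section \<open>Polynomial inequalities for the approximate inverse of the rate function\<close>

text \<open>The first hypothesis is what cancels the linear term, so that \<open>z^2\<close> factors
  out. Taylor's value \<open>b = (1 + 3 a^2) / 16\<close> would also cancel the next term; for
  \<open>0 <= p <= 1\<close> it lies between 1/16 and 1/12.\<close>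

lemma inverse_Psi_identity:
  fixes a b p z D :: real
  assumes "2 * p = 1 - 3 * a" and "D = 1 - a * z + b * z\<^sup>2"
  shows "D * (D - p * z) * (D + (1 - p) * z) - (1 - b * z\<^sup>2)
    = z\<^sup>2 * ((4 * b - (1 + 3 * a\<^sup>2) / 4) + a * (1 - a\<^sup>2) / 4 * z
        + (3 * b\<^sup>2 - b * (1 + 3 * a\<^sup>2) / 4) * z\<^sup>2 + b ^ 3 * z ^ 4)"
proof -
  have "4 * (D * (D - p * z) * (D + (1 - p) * z) - (1 - b * z\<^sup>2))
    = z\<^sup>2 * ((16 * b - (1 + 3 * a\<^sup>2)) + a * (1 - a\<^sup>2) * z
        + (12 * b\<^sup>2 - b * (1 + 3 * a\<^sup>2)) * z\<^sup>2 + 4 * b ^ 3 * z ^ 4)"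
    using assms by algebra
  then show ?thesis by (simp add: field_simps)
qed

text \<open>For \<open>b = 1/12\<close> the constant coefficient in
  \<open>inverse_Psi_identity\<close> is \<open>(1 - 9 a^2) / 12\<close>, which just vanishes at
  \<open>p = 0\<close>. As \<open>a >= 0\<close>, only the \<open>z^2\<close> coefficient
  \<open>- a^2 / 16\<close> can be negative.\<close>

lemma inverse_Psi_bound_le_half:
  fixes p z :: real
  defines "D \<equiv> 1 - (1 - 2 * p) / 3 * z + 1 / 12 * z\<^sup>2"
  assumes p: "0 \<le> p" "p \<le> 1 / 2" and z: "0 \<le> z"
  shows "p * z < D" and "1 - 1 / 12 * z\<^sup>2 \<le> D * (D - p * z) * (D + (1 - p) * z)"
proof -
  define a where "a = (1 - 2 * p) / 3"
  have a: "0 \<le> a" "a \<le> 1 / 3" and pa: "p = (1 - 3 * a) / 2" using p by (auto simp: a_def field_simps)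
  have D: "D = 1 - a * z + 1 / 12 * z\<^sup>2" by (simp add: D_def a_def)
  have "(p + a) * z \<le> 1 / 2 * z" using p by (intro mult_right_mono z) (simp add: a_def field_simps)
  moreover have "0 < 1 - 1 / 2 * z + 1 / 12 * z\<^sup>2"
    using zero_le_power2 [of "z - 3"] by (simp add: power2_eq_square algebra_simps)
  ultimately show "p * z < D" by (simp add: D algebra_simps)
  have a2: "a\<^sup>2 \<le> 1 / 9" using power_mono [OF a(2,1), of 2] by (simp add: power2_eq_square)
  have "0 \<le> (4 * (1/12) - (1 + 3 * a\<^sup>2) / 4) + a * (1 - a\<^sup>2) / 4 * z
        + (3 * (1/12)\<^sup>2 - (1/12) * (1 + 3 * a\<^sup>2) / 4) * z\<^sup>2 + (1/12) ^ 3 * z ^ 4"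
  proof -
    have "0 \<le> (1 - 9 * a\<^sup>2) / 12" using a2 by simp
    moreover have "0 \<le> z * (a * (1 - a\<^sup>2) / 4 - a\<^sup>2 * z / 16 + z ^ 3 / 1728)"
    proof (intro mult_nonneg_nonneg z)
      \<comment> \<open>By \<open>a <= 1/3\<close> all three terms can be compared with multiples of
        \<open>a\<close>, which then factors out.\<close>
      have "a * (a * z) \<le> a * (z / 3)" using a z mult_right_mono [of a "1/3" z] by (intro mult_left_mono) auto
      then have 1: "a\<^sup>2 * z \<le> a * z / 3" by (simp add: power2_eq_square)
      have 2: "a * (8 / 9) \<le> a * (1 - a\<^sup>2)" using a a2 by (intro mult_left_mono) auto
      have 3: "a * z ^ 3 \<le> z ^ 3 / 3" using a z mult_right_mono [of a "1/3" "z ^ 3"] by simp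
      \<comment> \<open>Tangent to \<open>z ^ 3\<close> at 2: its slope 12 makes
        \<open>z ^ 3 / 576\<close> offset \<open>- z / 48\<close>.\<close>
      have "0 \<le> (z - 2)\<^sup>2 * (z + 4)" using z by simp
      then have "12 * z - 16 \<le> z ^ 3" by (simp add: power2_eq_square power3_eq_cube algebra_simps)
      then have "0 \<le> 2 / 9 - z / 48 + z ^ 3 / 576" by simp
      from mult_nonneg_nonneg [OF a(1) this]
      have "0 \<le> a * (2 / 9) - a * z / 48 + a * z ^ 3 / 576" by (simp add: algebra_simps)
      with 1 2 3 show "0 \<le> a * (1 - a\<^sup>2) / 4 - a\<^sup>2 * z / 16 + z ^ 3 / 1728"
        by linarith
    qed
    moreover have "(4 * (1/12) - (1 + 3 * a\<^sup>2) / 4) + a * (1 - a\<^sup>2) / 4 * z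
        + (3 * (1/12)\<^sup>2 - (1/12) * (1 + 3 * a\<^sup>2) / 4) * z\<^sup>2 + (1/12) ^ 3 * z ^ 4
      = (1 - 9 * a\<^sup>2) / 12 + z * (a * (1 - a\<^sup>2) / 4 - a\<^sup>2 * z / 16 + z ^ 3 / 1728)"
      by (simp add: power2_eq_square power3_eq_cube power4_eq_xxxx field_simps)
    ultimately show ?thesis by simp
  qed
  from mult_nonneg_nonneg [OF zero_le_power2 [of z] this]
  show "1 - 1 / 12 * z\<^sup>2 \<le> D * (D - p * z) * (D + (1 - p) * z)"
    using inverse_Psi_identity [of p a D z "1/12"] by (simp add: D pa)
qed

text \<open>For \<open>p > 1/2\<close> the \<open>z\<close> coefficient is negative, and with
  \<open>b = 1/12\<close> the constant coefficient would vanish at \<open>p = 1\<close>. With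
  \<open>b = 1/8\<close> it is at least 1/6, which pays for the linear term.\<close>

lemma inverse_Psi_bound_ge_half:
  fixes p z :: real
  defines "D \<equiv> 1 - (1 - 2 * p) / 3 * z + 1 / 8 * z\<^sup>2"
  assumes p: "1 / 2 \<le> p" "p \<le> 1" and z: "0 \<le> z"
  shows "p * z < D" and "1 - 1 / 8 * z\<^sup>2 \<le> D * (D - p * z) * (D + (1 - p) * z)"
proof -
  define a where "a = (1 - 2 * p) / 3"
  have a: "a \<le> 0" "- (1 / 3) \<le> a" and pa: "p = (1 - 3 * a) / 2" using p by (auto simp: a_def field_simps)
  have D: "D = 1 - a * z + 1 / 8 * z\<^sup>2" by (simp add: D_def a_def)
  have "(p + a) * z \<le> 2 / 3 * z" using p by (intro mult_right_mono z) (simp add: a_def field_simps)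
  moreover have "0 < 1 - 2 / 3 * z + 1 / 8 * z\<^sup>2"
    using zero_le_power2 [of "z - 8 / 3"] by (simp add: power2_eq_square algebra_simps)
  ultimately show "p * z < D" by (simp add: D algebra_simps)
  have a2: "a\<^sup>2 \<le> 1 / 9" using power_mono [of "-a" "1/3" 2] a by (simp add: power2_eq_square)
  have "0 \<le> (4 * (1/8) - (1 + 3 * a\<^sup>2) / 4) + a * (1 - a\<^sup>2) / 4 * z
        + (3 * (1/8)\<^sup>2 - (1/8) * (1 + 3 * a\<^sup>2) / 4) * z\<^sup>2 + (1/8) ^ 3 * z ^ 4"
  proof -
    \<comment> \<open>On the range of \<open>a\<close> the minimum of \<open>a (1 - a^2)\<close> is
      -8/27, attained at \<open>a = -1/3\<close>; this root is split off.\<close>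
    have "0 \<le> (1 / 3 + a) * (8 / 9 - a * (a - 1 / 3))"
    proof -
      have "a * a - a * (1 / 3) \<le> 2 / 9" using a a2 by (simp add: power2_eq_square)
      then show ?thesis using a by (intro mult_nonneg_nonneg) (auto simp: algebra_simps)
    qed
    also have "(1 / 3 + a) * (8 / 9 - a * (a - 1 / 3)) = 8 / 27 + a * (1 - a\<^sup>2)"
      by (simp add: power2_eq_square field_simps)
    finally have "- (8 / 27) \<le> a * (1 - a\<^sup>2)" by simp
    from mult_right_mono [OF this z]
    have 1: "- (8 / 27) * z \<le> a * (1 - a\<^sup>2) * z" by simp
    have 2: "1 / 192 * z\<^sup>2 \<le> (3 * (1/8)\<^sup>2 - (1/8) * (1 + 3 * a\<^sup>2) / 4) * z\<^sup>2"
      using a2 by (intro mult_right_mono) (auto simp: power2_eq_square)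
    \<comment> \<open>Replaces the quartic by its tangent in \<open>z^2\<close> at 4, which leaves a
      quadratic of negative discriminant.\<close>
    have "0 \<le> (z\<^sup>2 - 4)\<^sup>2" by simp
    then have 3: "8 * z\<^sup>2 - 16 \<le> z ^ 4" by (simp add: power2_eq_square power4_eq_xxxx algebra_simps)
    have 4: "0 \<le> 13 / 96 - 2 / 27 * z + 1 / 48 * z\<^sup>2"
      using zero_le_power2 [of "z - 16 / 9"] by (simp add: power2_eq_square algebra_simps)
    have "0 \<le> 1 / 6 - 2 / 27 * z + 1 / 192 * z\<^sup>2 + (1 / 8) ^ 3 * z ^ 4"
      using 3 4 by (simp add: power3_eq_cube)
    moreover have "1 / 6 \<le> 4 * (1/8) - (1 + 3 * a\<^sup>2) / 4" using a2 by simp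
    moreover have "a * (1 - a\<^sup>2) / 4 * z = a * (1 - a\<^sup>2) * z / 4" by simp
    ultimately show ?thesis using 1 2 by linarith
  qed
  from mult_nonneg_nonneg [OF zero_le_power2 [of z] this]
  show "1 - 1 / 8 * z\<^sup>2 \<le> D * (D - p * z) * (D + (1 - p) * z)"
    using inverse_Psi_identity [of p a D z "1/8"] by (simp add: D pa)
qed

section \<open>The Gaussian integral and the derivative of the distribution function\<close>

lemma integral_gauss_le:
  "integral {0..x} (\<lambda>t. exp (- t\<^sup>2)) \<le> sqrt pi / 2"
proof -
  have "((\<lambda>t::real. indicator {0..} t *\<^sub>R exp (- t\<^sup>2)) has_integral (sqrt pi / 2)) UNIV"
    using has_integral_integral_lborel [of "\<lambda>t::real. indicator {0..} t *\<^sub>R exp (- t\<^sup>2)"] gaussian_moment_0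
    by (simp only: has_bochner_integral_iff)
  then have I: "((\<lambda>t::real. exp (- t\<^sup>2)) has_integral (sqrt pi / 2)) {0..}"
    unfolding has_integral_restrict_UNIV [of "{0..}", symmetric]
    by (rule has_integral_eq [rotated]) (simp add: indicator_def del: has_integral_restrict_UNIV)
  have "integral {0..x} (\<lambda>t. exp (- t\<^sup>2)) \<le> integral {0..} (\<lambda>t::real. exp (- t\<^sup>2))"
  proof (rule integral_subset_le)
    show "(\<lambda>t. exp (- t\<^sup>2)) integrable_on {0..x}"
      by (intro integrable_continuous_interval continuous_intros)
  qed (use has_integral_integrable [OF I] in simp_all)
  with integral_unique [OF I] show ?thesis by simp
qed

lemma has_real_derivative_integral_gauss:
  assumes "0 < x"
  shows "((\<lambda>x. integral {0..x} (\<lambda>t. exp (- t\<^sup>2))) has_real_derivative exp (- x\<^sup>2)) (at x)"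
proof -
  have "continuous_on {0..x+1} (\<lambda>t::real. exp (- t\<^sup>2))"
    by (intro continuous_intros)
  then have "((\<lambda>x. integral {0..x} (\<lambda>t. exp (- t\<^sup>2))) has_real_derivative exp (- x\<^sup>2)) (at x within {0..x+1})"
    by (rule integral_has_real_derivative) (use assms in simp)
  then have "((\<lambda>x. integral {0..x} (\<lambda>t. exp (- t\<^sup>2))) has_real_derivative exp (- x\<^sup>2)) (at x within {0<..<x+1})"
    by (rule DERIV_subset) (auto simp: subset_iff)
  moreover have "at x within {0<..<x+1} = at x"
    using assms by (intro at_within_open) auto
  ultimately show ?thesis by simp
qed

text \<open>The derivatives of the summands telescope, because
  \<open>(k + 1) (n choose (k + 1)) = (n - k) (n choose k)\<close>.\<close>

lemma has_real_derivative_binom_cdf: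
  assumes "k < n"
  shows "(binom_cdf n k has_real_derivative
           - (real (n - k) * real (n choose k) * x ^ k * (1 - x) ^ (n - k - 1))) (at x)"
  using assms
proof (induction k)
  case 0
  show ?case unfolding binom_cdf_def [abs_def] Bernstein_def
    by (auto intro!: derivative_eq_intros simp: fun_eq_iff)
next
  case (Suc k)
  have eq: "binom_cdf n (Suc k) = (\<lambda>x. binom_cdf n k x + Bernstein n (Suc k) x)"
    by (auto simp: binom_cdf_def)
  have ch: "real (Suc k) * real (n choose Suc k) = real (n - k) * real (n choose k)"
    using binomial_absorb_comp [of n k] Suc.prems
    by (metis binomial_absorption of_nat_mult)
  have dB: "(Bernstein n (Suc k) has_real_derivative
      real (n choose Suc k) * (real (Suc k) * x ^ k) * (1 - x) ^ (n - Suc k)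
       - real (n choose Suc k) * x ^ Suc k * (real (n - Suc k) * (1 - x) ^ (n - Suc k - 1))) (at x)"
    unfolding Bernstein_def [abs_def]
    by (rule derivative_eq_intros refl)+ (simp add: algebra_simps)
  obtain m where n: "n = Suc (Suc (k + m))" using Suc.prems less_imp_Suc_add [of "Suc k" n] by auto
  have "- (real (m + 2) * real (n choose k) * x ^ k * (1 - x) ^ Suc m)
      + (real (n choose Suc k) * (real (Suc k) * x ^ k) * (1 - x) ^ Suc m
         - real (n choose Suc k) * x ^ Suc k * (real (Suc m) * (1 - x) ^ m))
      = - (real (Suc m) * real (n choose Suc k) * x ^ Suc k * (1 - x) ^ m)
        + (real (Suc k) * real (n choose Suc k) - real (m + 2) * real (n choose k)) * x ^ k * (1 - x) ^ Suc m"
    by (simp only: algebra_simps)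
  moreover have "n - k = m + 2" by (simp add: n)
  ultimately have "- (real (m + 2) * real (n choose k) * x ^ k * (1 - x) ^ Suc m)
      + (real (n choose Suc k) * (real (Suc k) * x ^ k) * (1 - x) ^ Suc m
         - real (n choose Suc k) * x ^ Suc k * (real (Suc m) * (1 - x) ^ m))
      = - (real (Suc m) * real (n choose Suc k) * x ^ Suc k * (1 - x) ^ m)"
    using ch by simp
  note sum = this
  have sub: "n - k = m + 2" "m + 2 - 1 = Suc m" "n - Suc k = Suc m" "Suc m - 1 = m"
    by (simp_all add: n)
  show ?case
    unfolding eq
    by (rule DERIV_cong [OF DERIV_add [OF Suc.IH [OF Suc_lessD [OF Suc.prems]] dB]])
       (use sum in \<open>simp only: sub\<close>)
qed

text \<open>Machin's formula, with partial sums of the alternating arctangent series as upper and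
  lower bounds.\<close>

lemma pi_bounds: "3 < pi" "pi < 3.142"
proof -
  have up: "arctan x \<le> x - x ^ 3 / 3 + x ^ 5 / 5" if "0 \<le> x" for x :: real
  proof -
    let ?f = "\<lambda>x::real. x - x ^ 3 / 3 + x ^ 5 / 5 - arctan x"
    have "?f 0 \<le> ?f x"
    proof (rule DERIV_nonneg_imp_nondecreasing [OF that], intro exI conjI)
      fix t :: real
      show "(?f has_real_derivative (1 - t\<^sup>2 + t ^ 4 - inverse (1 + t\<^sup>2))) (at t)"
        by (auto intro!: derivative_eq_intros)
      have "1 - t\<^sup>2 + t ^ 4 - inverse (1 + t\<^sup>2) = t ^ 6 / (1 + t\<^sup>2)"
      proof -
        have "1 + t\<^sup>2 > 0" by (simp add: add_pos_nonneg)
        then show ?thesis by (simp add: field_simps eval_nat_numeral)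
      qed
      then show "0 \<le> 1 - t\<^sup>2 + t ^ 4 - inverse (1 + t\<^sup>2)" by simp
    qed
    then show ?thesis by simp
  qed
  have lo: "x - x ^ 3 / 3 \<le> arctan x" if "0 \<le> x" for x :: real
  proof -
    let ?f = "\<lambda>x::real. arctan x - (x - x ^ 3 / 3)"
    have "?f 0 \<le> ?f x"
    proof (rule DERIV_nonneg_imp_nondecreasing [OF that], intro exI conjI)
      fix t :: real
      show "(?f has_real_derivative (inverse (1 + t\<^sup>2) - (1 - t\<^sup>2))) (at t)"
        by (auto intro!: derivative_eq_intros)
      have "inverse (1 + t\<^sup>2) - (1 - t\<^sup>2) = t ^ 4 / (1 + t\<^sup>2)"
      proof -
        have "1 + t\<^sup>2 > 0" by (simp add: add_pos_nonneg)
        then show ?thesis by (simp add: field_simps eval_nat_numeral)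
      qed
      then show "0 \<le> inverse (1 + t\<^sup>2) - (1 - t\<^sup>2)" by simp
    qed
    then show ?thesis by simp
  qed
  show "3 < pi"
    using machin lo [of "1/5"] up [of "1/239"] by (simp add: eval_nat_numeral)
  show "pi < 3.142"
    using machin up [of "1/5"] lo [of "1/239"] by (simp add: eval_nat_numeral)
qed

section \<open>The Gaussian upper bound for the ratio\<close>

text \<open>For \<open>p = k / (k + q)\<close> the real exponent \<open>k (1 - p) / p\<close> is
  \<open>q\<close>, and the right-hand side becomes \<open>(1 - u/q)^q (1 + u/k)^k\<close> at
  \<open>u = k (1 - p) v\<close>.\<close>

lemma exp_Psi:
  assumes "0 < p" "p < 1" "0 \<le> v" "p * v < 1"
  shows "exp (- (real k * (1 - p) * Psi p v)) =
    (1 + (1 - p) * v) ^ k * (1 - p * v) powr (real k * (1 - p) / p)"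
proof -
  have pos: "1 - p * v > 0" "1 + (1 - p) * v > 0"
    using assms by (auto intro!: add_pos_nonneg mult_nonneg_nonneg)
  have "- (real k * (1 - p) * Psi p v)
      = real k * ln (1 + (1 - p) * v) + real k * (1 - p) / p * ln (1 - p * v)"
    using assms by (simp add: Psi_def field_simps)
  then show ?thesis
    using pos by (simp add: exp_add powr_def flip: powr_realpow)
qed

lemma binom_cdf_1:
  assumes "k < n"
  shows "binom_cdf n k 1 = 0"
  using assms unfolding binom_cdf_def Bernstein_def by (intro sum.neutral) auto

text \<open>The bound is the integral of
  \<open>\<sigma>^2 exp (- \<sigma>^2 z^2 / 2) (D z + (1 - p) z)\<close> over \<open>z >= 0\<close>,
  where \<open>D z + (1 - p) z = 1 + (2 - p)/3 z + b z^2\<close>. The parameter \<open>b\<close>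
  stays free because the two ranges of \<open>p\<close> use different values.\<close>

lemma binom_cdf_ratio_le:
  fixes k q :: nat and a b p \<sigma> :: real
  defines "n \<equiv> k + q" and "D \<equiv> \<lambda>z. 1 - (1 - 2 * p) / 3 * z + b * z\<^sup>2"
  assumes k: "1 \<le> k" and q: "1 \<le> q" and b: "0 \<le> b"
    and p_def: "p = real k / real n" and \<sigma>_def: "\<sigma> = sqrt (real k * (1 - p))"
    and above: "\<And>x. 0 \<le> x \<Longrightarrow> p * x < D x"
    and key: "\<And>x. 0 \<le> x \<Longrightarrow> 1 - b * x\<^sup>2 \<le> D x * (D x - p * x) * (D x + (1 - p) * x)"
  shows "binom_cdf n k p / Bernstein n k p \<le> sqrt (pi / 2) * (\<sigma> + b / \<sigma>) + (2 - p) / 3"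
proof -
  have p: "0 < p" "p < 1" using k q by (auto simp: p_def n_def field_simps)
  have qp: "real q * p = real k * (1 - p)" using k by (simp add: p_def n_def field_simps)
  have \<sigma>: "0 < \<sigma>" "\<sigma>\<^sup>2 = real k * (1 - p)" using k p by (auto simp: \<sigma>_def)
  have Bpos: "Bernstein n k p > 0" using p by (intro Bernstein_pos) (auto simp: n_def)
  define F where "F = (\<lambda>v. binom_cdf n k (p * (1 + (1 - p) * v)) / Bernstein n k p)"
  \<comment> \<open>\<open>F\<close> runs from the left-hand side at \<open>v = 0\<close> to \<open>0\<close> at \<open>v = 1 / p\<close>. \<open>H \<circ> Y\<close> grows at least as fast
      as \<open>F\<close> decays, because \<open>sqrt (2 Psi p v) \<le> v D (sqrt (2 Psi p v))\<close>.\<close>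
  define Er where "Er = (\<lambda>x::real. integral {0..x} (\<lambda>t. exp (- t\<^sup>2)))"
  define H where "H = (\<lambda>y. sqrt 2 * (\<sigma> + b / \<sigma>) * Er y - ((2 - p) / 3 + b * sqrt 2 / \<sigma> * y) * exp (- y\<^sup>2))"
  define Y where "Y = (\<lambda>v. \<sigma> * sqrt (Psi p v))"
  have less: "p * x < 1" if "x \<le> v" "p * v < 1" for x v
    using that p mult_left_mono [of x v p] by linarith
  have Psi_nonneg: "0 \<le> Psi p v" if "0 \<le> v" "p * v < 1" for v
    using Psi_strict_mono [of p 0 v] p that by (cases "v = 0") auto

  \<comment> \<open>The exponential is \<open>(1 + (1 - p) v)^k (1 - p v)^q\<close>; dividing by
    \<open>1 - p v\<close> yields the exponent \<open>q - 1\<close> of the derivative.\<close>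
  have dF: "(F has_real_derivative - (\<sigma>\<^sup>2 * exp (- (Y v)\<^sup>2) / (1 - p * v))) (at v)"
    if v: "0 \<le> v" "p * v < 1" for v
  proof -
    have "((\<lambda>v. p * (1 + (1 - p) * v)) has_real_derivative p * (1 - p)) (at v)"
      by (auto intro!: derivative_eq_intros)
    from DERIV_cdivide [OF DERIV_chain2 [OF has_real_derivative_binom_cdf [of k n] this], of "Bernstein n k p"]
    have "(F has_real_derivative
       - (real q * real (n choose k) * (p * (1 + (1 - p) * v)) ^ k
           * (1 - p * (1 + (1 - p) * v)) ^ (q - 1)) * (p * (1 - p)) / Bernstein n k p) (at v)"
      using q by (simp add: F_def n_def)
    moreover have "- (real q * real (n choose k) * (p * (1 + (1 - p) * v)) ^ k
           * (1 - p * (1 + (1 - p) * v)) ^ (q - 1)) * (p * (1 - p)) / Bernstein n k p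
         = - (\<sigma>\<^sup>2 * exp (- (Y v)\<^sup>2) / (1 - p * v))"
    proof -
      have "(Y v)\<^sup>2 = real k * (1 - p) * Psi p v"
        using Psi_nonneg [OF v] by (simp add: Y_def power_mult_distrib \<sigma>)
      then have e: "exp (- (Y v)\<^sup>2) = (1 + (1 - p) * v) ^ k * (1 - p * v) ^ q"
        using exp_Psi [OF p v, of k] qp [symmetric] p v by (simp add: powr_realpow)
      obtain m where m: "q = Suc m" using q not0_implies_Suc by fastforce
      have "1 - p * (1 + (1 - p) * v) = (1 - p) * (1 - p * v)" by (simp add: algebra_simps)
      moreover have "Bernstein n k p = real (n choose k) * p ^ k * (1 - p) ^ q"
        by (simp add: Bernstein_def n_def)
      moreover have "real (n choose k) > 0" by (simp add: n_def)
      ultimately show ?thesis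
        using p v unfolding e \<sigma> qp [symmetric]
        by (simp add: m power_mult_distrib)
    qed
    ultimately show ?thesis by simp
  qed

  \<comment> \<open>At \<open>y = \<sigma> z / sqrt 2\<close> the second factor is
    \<open>sqrt 2 * \<sigma> * (D z + (1 - p) z)\<close>; \<open>H\<close> is an antiderivative
    found by integrating the \<open>y^2\<close> term by parts.\<close>
  have dH: "(H has_real_derivative
       exp (- y\<^sup>2) * (sqrt 2 * \<sigma> + 2 * y * (2 - p) / 3 + 2 * sqrt 2 * b * y\<^sup>2 / \<sigma>)) (at y)"
    if "0 < y" for y
  proof -
    have 1: "(Er has_real_derivative exp (- y\<^sup>2)) (at y)"
      unfolding Er_def by (rule has_real_derivative_integral_gauss) fact
    have 2: "((\<lambda>y. exp (- y\<^sup>2)) has_real_derivative exp (- y\<^sup>2) * (- 2 * y)) (at y)"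
      by (auto intro!: derivative_eq_intros)
    have 3: "((\<lambda>y. (2 - p) / 3 + b * sqrt 2 / \<sigma> * y) has_real_derivative b * sqrt 2 / \<sigma>) (at y)"
      using DERIV_add [OF DERIV_const [of "(2 - p) / 3"] DERIV_cmult_Id [of "b * sqrt 2 / \<sigma>"]] by simp
    show ?thesis
      unfolding H_def
      by (rule DERIV_cong [OF DERIV_diff [OF DERIV_cmult [OF 1] DERIV_mult [OF 3 2]]])
         (use \<sigma> in \<open>simp add: field_simps power2_eq_square\<close>)
  qed

  have mono: "F 0 + H 0 \<le> F v + H (Y v)" if v: "0 < v" "p * v < 1" for v
  proof -
    have "F 0 + H (Y 0) \<le> F v + H (Y v)"
    \<comment> \<open>The square root in \<open>Y\<close> blocks the chain rule at 0, so derivatives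
      are taken in the open interval and continuity covers the endpoints.\<close>
    proof (rule DERIV_nonneg_imp_increasing_open [of 0 v "\<lambda>v. F v + H (Y v)"])
      fix x assume x: "0 < x" "x < v"
      have px: "p * x < 1" using less [of x v] x v by simp
      have P: "Psi p x > 0" using Psi_strict_mono [of p 0 x] p x px by simp
      define z where "z = sqrt (2 * Psi p x)"
      have z: "z > 0" using P by (simp add: z_def)
      have Yz: "Y x = \<sigma> * z / sqrt 2" by (simp add: Y_def z_def real_sqrt_mult)
      then have Ypos: "Y x > 0" using z \<sigma> by simp
      define w where "w = (1 - p * x) * (1 + (1 - p) * x)"
      have w: "w > 0" "1 - p * x > 0" "1 + (1 - p) * x > 0"
        using px x p by (auto simp: w_def intro!: mult_pos_pos add_pos_nonneg)
      have "(Y has_real_derivative \<sigma> * (inverse (sqrt (Psi p x)) / 2 * (x / w))) (at x)"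
        unfolding Y_def w_def
        by (intro DERIV_cmult DERIV_chain2 [OF DERIV_real_sqrt has_real_derivative_Psi] p P px) (use x in simp)
      also have "\<sigma> * (inverse (sqrt (Psi p x)) / 2 * (x / w)) = \<sigma> * x / (sqrt 2 * z * w)"
        by (simp add: z_def real_sqrt_mult field_simps)
      finally have dY: "(Y has_real_derivative \<sigma> * x / (sqrt 2 * z * w)) (at x)" .
      have H': "sqrt 2 * \<sigma> + 2 * Y x * (2 - p) / 3 + 2 * sqrt 2 * b * (Y x)\<^sup>2 / \<sigma>
          = sqrt 2 * \<sigma> * (D z + (1 - p) * z)"
      proof -
        have "sqrt 2 * Y x = \<sigma> * z" by (simp add: Yz)
        moreover have "2 * Y x = sqrt 2 * (sqrt 2 * Y x)" by simp
        moreover have "2 * (Y x)\<^sup>2 = \<sigma>\<^sup>2 * z\<^sup>2" by (simp add: Yz power_mult_distrib power_divide)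
        ultimately show ?thesis
          using \<sigma> by (simp add: D_def field_simps power2_eq_square)
      qed
      have "((\<lambda>v. F v + H (Y v)) has_real_derivative
          - (\<sigma>\<^sup>2 * exp (- (Y x)\<^sup>2) / (1 - p * x))
          + exp (- (Y x)\<^sup>2) * (sqrt 2 * \<sigma> * (D z + (1 - p) * z)) * (\<sigma> * x / (sqrt 2 * z * w))) (at x)"
        using DERIV_add [OF dF DERIV_chain2 [OF dH dY]] x px Ypos unfolding H' by simp
      \<comment> \<open>The terms with \<open>(1 - p) x z\<close> cancel, so the sign is that of
        \<open>x * D z - z\<close>.\<close>
      also have "- (\<sigma>\<^sup>2 * exp (- (Y x)\<^sup>2) / (1 - p * x))
          + exp (- (Y x)\<^sup>2) * (sqrt 2 * \<sigma> * (D z + (1 - p) * z)) * (\<sigma> * x / (sqrt 2 * z * w))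
          = \<sigma>\<^sup>2 * exp (- (Y x)\<^sup>2) / (z * w) * (x * D z - z)"
      proof -
        define K where "K = \<sigma>\<^sup>2 * exp (- (Y x)\<^sup>2) / (z * w)"
        have "exp (- (Y x)\<^sup>2) * (sqrt 2 * \<sigma> * (D z + (1 - p) * z)) * (\<sigma> * x / (sqrt 2 * z * w))
          = K * (x * (D z + (1 - p) * z))"
          by (simp add: K_def power2_eq_square)
        moreover have "\<sigma>\<^sup>2 * exp (- (Y x)\<^sup>2) / (1 - p * x) = K * (z * (1 + (1 - p) * x))"
          using w z by (simp add: K_def w_def)
        moreover have "- (K * (z * (1 + (1 - p) * x))) + K * (x * (D z + (1 - p) * z)) = K * (x * D z - z)"
          by (simp add: algebra_simps)
        ultimately show ?thesis unfolding K_def by argo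
      qed
      finally have "((\<lambda>v. F v + H (Y v)) has_real_derivative
          \<sigma>\<^sup>2 * exp (- (Y x)\<^sup>2) / (z * w) * (x * D z - z)) (at x)" .
      moreover have "z \<le> x * D z"
        unfolding z_def D_def
        by (rule sqrt_Psi_le [OF p _ px]) (use x above key in \<open>auto simp: D_def\<close>)
      ultimately show "\<exists>y. ((\<lambda>v. F v + H (Y v)) has_real_derivative y) (at x) \<and> y \<ge> 0"
        using z w by (intro exI conjI) (auto intro!: mult_nonneg_nonneg divide_nonneg_nonneg)
    next
      have "continuous_on {0..v} F"
        using less [OF _ v(2)] by (intro continuous_at_imp_continuous_on ballI DERIV_isCont [OF dF]) auto
      moreover have cY: "continuous_on {0..v} Y"
      proof -
        have "continuous_on {0..v} (Psi p)"
          using less [OF _ v(2)] p by (intro continuous_at_imp_continuous_on ballI DERIV_isCont [OF has_real_derivative_Psi]) auto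
        then show ?thesis unfolding Y_def by (intro continuous_intros)
      qed
      moreover have "continuous_on (Y ` {0..v}) H"
      proof -
        have "bdd_above (Y ` {0..v})"
          using compact_continuous_image [OF cY] by (intro bounded_imp_bdd_above compact_imp_bounded) auto
        then obtain M where M: "\<And>x. x \<in> {0..v} \<Longrightarrow> Y x \<le> M" unfolding bdd_above_def by blast
        have "0 \<le> Y x" if "x \<in> {0..v}" for x
          using that \<sigma>(1) Psi_nonneg [of x] less [of x v] v by (simp add: Y_def)
        with M have "Y ` {0..v} \<subseteq> {0..M}" by auto
        moreover have "continuous_on {0..M} Er"
          unfolding Er_def
          by (intro indefinite_integral_continuous_1 integrable_continuous_interval continuous_intros)
        then have "continuous_on {0..M} H"
          unfolding H_def by (intro continuous_intros)
        ultimately show ?thesis by (rule continuous_on_subset [rotated])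
      qed
      ultimately show "continuous_on {0..v} (\<lambda>v. F v + H (Y v))"
        by (intro continuous_on_add continuous_on_compose2 [of _ H _ Y]) auto
    qed (use v in simp)
    then show ?thesis by (simp add: Y_def)
  qed

  have H_le: "H y \<le> sqrt (pi / 2) * (\<sigma> + b / \<sigma>)" if "0 \<le> y" for y
  proof -
    have "H y \<le> sqrt 2 * (\<sigma> + b / \<sigma>) * Er y"
      unfolding H_def using b \<sigma> p that by (simp add: add_nonneg_nonneg)
    also have "\<dots> \<le> sqrt 2 * (\<sigma> + b / \<sigma>) * (sqrt pi / 2)"
      unfolding Er_def using b \<sigma> by (intro mult_left_mono integral_gauss_le) auto
    also have "\<dots> = sqrt 2 / 2 * sqrt pi * (\<sigma> + b / \<sigma>)" by simp
    also have "sqrt 2 / 2 * sqrt pi = sqrt (pi / 2)" by (simp add: real_sqrt_divide field_simps)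
    finally show ?thesis .
  qed

  \<comment> \<open>\<open>Psi p\<close> has a logarithmic singularity at \<open>1 / p\<close>, so
    this endpoint is reached by a left limit; \<open>F\<close> is a polynomial and hence continuous
    there.\<close>
  have ev: "\<forall>\<^sub>F v in at_left (1 / p). F 0 + H 0 \<le> F v + sqrt (pi / 2) * (\<sigma> + b / \<sigma>)"
    unfolding eventually_at_left_field
  proof (intro exI [of _ 0] conjI allI impI)
    show "0 < 1 / p" using p by simp
    fix v assume "0 < v" "v < 1 / p"
    then have v: "0 < v" "p * v < 1" using p by (auto simp: field_simps)
    have "0 \<le> Y v" using \<sigma> Psi_nonneg v by (simp add: Y_def)
    from mono [OF v] H_le [OF this]
    show "F 0 + H 0 \<le> F v + sqrt (pi / 2) * (\<sigma> + b / \<sigma>)" by linarith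
  qed
  have "isCont F (1 / p)"
  proof -
    have "((\<lambda>v. p * (1 + (1 - p) * v)) has_real_derivative p * (1 - p)) (at (1 / p))"
      by (auto intro!: derivative_eq_intros)
    from DERIV_isCont [OF DERIV_cdivide [OF DERIV_chain2 [OF has_real_derivative_binom_cdf [of k n] this]]] q
    show ?thesis by (simp add: F_def n_def)
  qed
  then have "(F \<longlongrightarrow> F (1 / p)) (at_left (1 / p))"
    by (simp add: isCont_def filterlim_at_split)
  moreover have "F (1 / p) = 0"
  proof -
    have "p * (1 + (1 - p) * (1 / p)) = 1" using p by (simp add: field_simps)
    then show ?thesis using binom_cdf_1 [of k n] q by (simp add: F_def n_def)
  qed
  ultimately have "((\<lambda>v. F v + sqrt (pi / 2) * (\<sigma> + b / \<sigma>)) \<longlongrightarrow> 0 + sqrt (pi / 2) * (\<sigma> + b / \<sigma>)) (at_left (1 / p))"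
    by (intro tendsto_intros) simp
  from tendsto_lowerbound [OF this ev] have "F 0 + H 0 \<le> sqrt (pi / 2) * (\<sigma> + b / \<sigma>)"
    by simp
  then show ?thesis by (simp add: F_def H_def Er_def)
qed

section \<open>Numerical consequences\<close>

text \<open>The left-hand side is the start of the expansion of the root in powers of
  \<open>1 / s\<close>; its square misses \<open>s^2 + 1/4\<close> by an explicit nonnegative
  term.\<close>

lemma sqrt_plus_quarter_ge:
  fixes s :: real
  assumes "0 < s" "1 / 2 \<le> s\<^sup>2"
  shows "s + 1 / (8 * s) - 1 / (128 * s ^ 3) \<le> sqrt (s\<^sup>2 + 1 / 4)"
proof (rule real_le_rsqrt)
  have "(s + 1 / (8 * s) - 1 / (128 * s ^ 3))\<^sup>2
      = s\<^sup>2 + 1 / 4 - (32 * s\<^sup>2 - 1) / (16384 * s ^ 6)"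
    using assms by (simp add: field_simps power2_eq_square) (simp add: algebra_simps eval_nat_numeral)
  also have "\<dots> \<le> s\<^sup>2 + 1 / 4"
    using assms by simp
  finally show "(s + 1 / (8 * s) - 1 / (128 * s ^ 3))\<^sup>2 \<le> s\<^sup>2 + 1 / 4" .
qed

text \<open>The term \<open>1 / 8 / s\<close> matches the expansion of the root, so constants
  decide: the cubic remainder is at most 3/100, and \<open>S * 47/100 >= 0.564\<close> exceeds
  \<open>(2 - p) / 3 <= 1/2\<close>.\<close>

lemma bound_ge_half:
  fixes s S p :: real
  assumes s: "0 < s" "1 / 2 \<le> s\<^sup>2" and S: "6 / 5 \<le> S" and p: "1 / 2 \<le> p"
  shows "S * (s + 1 / 8 / s) + (2 - p) / 3 < S * (1 / 2 + sqrt (s\<^sup>2 + 1 / 4))"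
proof -
  have "7 / 10 \<le> s"
    by (rule power2_le_imp_le) (use s in \<open>auto simp: power2_eq_square\<close>)
  from power_mono [OF this, of 3] have "343 / 1000 \<le> s ^ 3"
    by (simp add: power3_eq_cube)
  then have "1 / (128 * s ^ 3) \<le> 3 / 100"
    using s by (simp add: field_simps)
  with sqrt_plus_quarter_ge [OF s] have "47 / 100 + (s + 1 / 8 / s) \<le> 1 / 2 + sqrt (s\<^sup>2 + 1 / 4)"
    by simp
  then have "S * (47 / 100 + (s + 1 / 8 / s)) \<le> S * (1 / 2 + sqrt (s\<^sup>2 + 1 / 4))"
    using S by (intro mult_left_mono) auto
  moreover have "(2 - p) / 3 < S * (47 / 100)" using S p by simp
  ultimately show ?thesis unfolding distrib_left by linarith
qed

text \<open>1.2534 rounds \<open>sqrt (pi / 2)\<close> up and 1.25901 rounds 180451625/143327232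
  down. The quadratic factor in \<open>s\<close> below has negative discriminant for
  \<open>p >= 0.04\<close>; for \<open>p = 0\<close> it has real roots, both below 4.89.\<close>

lemma bound_lt_half:
  fixes s S p :: real
  assumes s: "0 < s" "1 / 2 \<le> s\<^sup>2" and S: "S \<le> 1.2534" and p: "0 \<le> p"
    and "p \<ge> 0.04 \<or> s \<ge> 4.89"
  shows "S * (s + 1 / 12 / s) + (2 - p) / 3 < 1.25901 * (1 / 2 + sqrt (s\<^sup>2 + 1 / 4))"
proof -
  \<comment> \<open>\<open>s ^ 3\<close> times the difference of the two sides, with
    \<open>S\<close> raised to 1.2534, the root replaced by its expansion, and coefficients rounded
    unfavourably; for instance \<open>0.00561 = 1.25901 - 1.2534\<close>.\<close>
  have "0 < s\<^sup>2 * (0.00561 * s\<^sup>2 + (p / 3 - 0.037162) * s + 0.0529) - 0.00984"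
    using assms(5)
  proof
    assume p: "p \<ge> 0.04"
    have "(0.04 / 3 - 0.037162) * s \<le> (p / 3 - 0.037162) * s"
      using p s by (intro mult_right_mono) auto
    moreover have "0.025 \<le> 0.00561 * s\<^sup>2 + (0.04 / 3 - 0.037162) * s + 0.0529"
      using zero_le_power2 [of "s - 35743 / 16830"] by (simp add: power2_eq_square algebra_simps)
    ultimately have "(1 / 2) * 0.025 \<le> s\<^sup>2 * (0.00561 * s\<^sup>2 + (p / 3 - 0.037162) * s + 0.0529)"
      using s by (intro mult_mono) auto
    then show ?thesis by simp
  next
    assume big: "s \<ge> 4.89"
    have "- 0.037162 * s \<le> (p / 3 - 0.037162) * s"
      using p s by (intro mult_right_mono) auto
    \<comment> \<open>Tangent to \<open>s^2\<close> at 4.89, which makes the estimate linear in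
      \<open>s\<close>.\<close>
    moreover have "9.78 * s - 23.9121 \<le> s\<^sup>2"
      using zero_le_power2 [of "s - 4.89"] by (simp add: power2_eq_square algebra_simps)
    ultimately have "0.004 \<le> 0.00561 * s\<^sup>2 + (p / 3 - 0.037162) * s + 0.0529"
      using big by simp
    moreover have "23 \<le> s\<^sup>2" using power_mono [OF big, of 2] by (simp add: power2_eq_square)
    ultimately have *: "23 * 0.004 \<le> s\<^sup>2 * (0.00561 * s\<^sup>2 + (p / 3 - 0.037162) * s + 0.0529)"
      using s by (intro mult_mono) auto
    have "0.00984 < 23 * (0.004 :: real)" by simp
    from less_le_trans [OF this *] show ?thesis by (simp only: diff_gt_0_iff_gt)
  qed
  then have "0 < (s\<^sup>2 * (0.00561 * s\<^sup>2 + (p / 3 - 0.037162) * s + 0.0529) - 0.00984) / s ^ 3"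
    using s by simp
  also have "\<dots> = 0.00561 * s + (p / 3 - 0.037162) + 0.0529 / s - 0.00984 / s ^ 3"
    using s by (simp add: divide_simps power2_eq_square power3_eq_cube) (simp add: algebra_simps)
  finally have pos: "0 < 0.00561 * s + (p / 3 - 0.037162) + 0.0529 / s - 0.00984 / s ^ 3" .
  have "S * (s + 1 / 12 / s) + (2 - p) / 3 \<le> 1.2534 * (s + 1 / 12 / s) + (2 - p) / 3"
    using S s by (intro add_right_mono mult_right_mono) auto
  also have "\<dots> < 1.25901 * (1 / 2 + (s + 1 / (8 * s) - 1 / (128 * s ^ 3)))"
  proof -
    define u w where "u = 1 / s" and "w = 1 / s ^ 3"
    have "0 < u" "0 < w" using s by (auto simp: u_def w_def)
    moreover have "0 < 0.00561 * s + (p / 3 - 0.037162) + 0.0529 * u - 0.00984 * w"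
      using pos by (simp add: u_def w_def)
    ultimately have "1.2534 * (s + u / 12) + (2 - p) / 3 < 1.25901 * (1 / 2 + (s + u / 8 - w / 128))"
      by (simp add: field_simps)
    then show ?thesis by (simp add: u_def w_def)
  qed
  also have "\<dots> \<le> 1.25901 * (1 / 2 + sqrt (s\<^sup>2 + 1 / 4))"
    using sqrt_plus_quarter_ge [OF s] by simp
  finally show ?thesis .
qed

section \<open>Expansion around the Poisson limit\<close>

text \<open>For \<open>i <= k\<close> and \<open>k > 0\<close> this is
  \<open>k! / ((k - i)! k^i)\<close>, the quotient of the Poisson probabilities at
  \<open>k - i\<close> and at \<open>k\<close> for mean \<open>k\<close>.\<close>

definition falling_ratio :: "nat \<Rightarrow> nat \<Rightarrow> real" where
  "falling_ratio k i = (\<Prod>m<i. 1 - real m / real k)"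

lemma falling_ratio_Suc: "falling_ratio k (Suc i) = falling_ratio k i * (1 - real i / real k)"
  by (simp add: falling_ratio_def)

lemma falling_ratio_nonneg:
  assumes "i \<le> k"
  shows "0 \<le> falling_ratio k i"
  unfolding falling_ratio_def using assms by (intro prod_nonneg) (auto simp: field_simps)

lemma falling_ratio_eq_0:
  assumes "0 < k"
  shows "falling_ratio k (Suc k) = 0"
  using assms by (simp add: falling_ratio_Suc)

text \<open>Telescopes by \<open>falling_ratio_Suc\<close>. At \<open>N = k\<close> the boundary
  term vanishes, so \<open>i (i + 1) / 2\<close> summed with these weights gives
  \<open>k / 2\<close> times the total weight.\<close>

lemma sum_falling_ratio_first:
  assumes "0 < k"
  shows "(\<Sum>i\<le>N. falling_ratio k i * (real (i * (i + 1)) / 2 - real k / 2))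
    = - (real k * (real N + 1) / 2 * falling_ratio k (Suc N))"
proof (induction N)
  case 0
  then show ?case by (simp add: falling_ratio_def)
next
  case (Suc N)
  have "falling_ratio k (Suc N) * (real (Suc N * (Suc N + 1)) / 2 - real k / 2)
      - real k * (real N + 1) / 2 * falling_ratio k (Suc N)
    = - (real k * (real (Suc N) + 1) / 2 * falling_ratio k (Suc (Suc N)))"
    using assms unfolding falling_ratio_Suc [of k "Suc N"] by (simp add: field_simps)
  then show ?case unfolding sum.atMost_Suc Suc.IH by linarith
qed

text \<open>Telescopes likewise; at \<open>N = k\<close> the weighted sum of
  \<open>(i (i + 1) / 2)^2\<close> is \<open>3 k^2 / 4\<close> times the total weight, minus
  \<open>k^2 / 2\<close>.\<close>

lemma sum_falling_ratio_second:
  assumes "0 < k"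
  shows "(\<Sum>i\<le>N. falling_ratio k i * ((real (i * (i + 1)) / 2)\<^sup>2 - 3 * (real k)\<^sup>2 / 4))
    = - (real k)\<^sup>2 / 2 - real k * (real N * (real N + 1)\<^sup>2 / 4 + real k * (3 * real N + 1) / 4)
        * falling_ratio k (Suc N)"
proof (induction N)
  case 0
  then show ?case by (simp add: falling_ratio_def power2_eq_square field_simps)
next
  case (Suc N)
  have "falling_ratio k (Suc N) * ((real (Suc N * (Suc N + 1)) / 2)\<^sup>2 - 3 * (real k)\<^sup>2 / 4)
     - real k * (real N * (real N + 1)\<^sup>2 / 4 + real k * (3 * real N + 1) / 4) * falling_ratio k (Suc N)
     = - (real k * (real (Suc N) * (real (Suc N) + 1)\<^sup>2 / 4 + real k * (3 * real (Suc N) + 1) / 4)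
        * falling_ratio k (Suc (Suc N)))"
    using assms unfolding falling_ratio_Suc [of k "Suc N"]
    by (simp add: field_simps power2_eq_square)
  then show ?case unfolding sum.atMost_Suc Suc.IH by linarith
qed

text \<open>\<open>T i = 1 + ... + i\<close> is the first-order coefficient of the product of the
  denominators, whose higher terms are nonnegative. Then \<open>1 / (1 + y) <= 1 - y + y^2\<close>
  at \<open>y = T i * e\<close>.\<close>

lemma prod_inverse_le:
  fixes e :: real
  assumes "0 \<le> e"
  defines "T \<equiv> \<lambda>i. real (i * (i + 1)) / 2"
  shows "(\<Prod>m<i. 1 / (1 + (real m + 1) * e)) \<le> 1 - T i * e + (T i)\<^sup>2 * e\<^sup>2"
proof -
  have "1 + T i * e \<le> (\<Prod>m<i. 1 + (real m + 1) * e)"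
  proof (induction i)
    case 0
    then show ?case by (simp add: T_def)
  next
    case (Suc i)
    have T: "0 \<le> T i" "T (Suc i) = T i + (real i + 1)" by (auto simp: T_def field_simps)
    have "1 + T (Suc i) * e \<le> (1 + T i * e) * (1 + (real i + 1) * e)"
      using T assms by (simp add: algebra_simps)
    also have "\<dots> \<le> (\<Prod>m<Suc i. 1 + (real m + 1) * e)"
      using Suc assms by (auto intro!: mult_right_mono)
    finally show ?case .
  qed
  moreover have T: "0 \<le> T i * e" using assms by (simp add: T_def)
  ultimately have "1 / (\<Prod>m<i. 1 + (real m + 1) * e) \<le> 1 / (1 + T i * e)"
    by (intro divide_left_mono mult_pos_pos) auto
  also have "\<dots> \<le> 1 - T i * e + (T i * e)\<^sup>2"
  proof -
    have "1 \<le> (1 - T i * e + (T i * e)\<^sup>2) * (1 + T i * e)"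
      using T zero_le_power [OF T, of 3] by (simp add: algebra_simps power2_eq_square power3_eq_cube)
    then show ?thesis using T by (simp add: divide_le_eq)
  qed
  finally show ?thesis by (simp add: prod_dividef power_mult_distrib)
qed

text \<open>Since \<open>(1 - p) / p = q / k\<close>, lowering the index from \<open>k - i\<close>
  by one contributes the Poisson factor \<open>(k - i) / k\<close> times the correction
  \<open>q / (q + i + 1)\<close>.\<close>

lemma Bernstein_ratio:
  fixes k q :: nat
  defines "p \<equiv> real k / real (k + q)"
  assumes "0 < k" "0 < q" "i \<le> k"
  shows "Bernstein (k + q) (k - i) p / Bernstein (k + q) k p
    = falling_ratio k i * (\<Prod>m<i. 1 / (1 + (real m + 1) * (1 / real q)))"
  using \<open>i \<le> k\<close>
proof (induction i)
  case 0
  have "0 < Bernstein (k + q) k p"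
    using assms by (intro Bernstein_pos) (auto simp: p_def)
  then show ?case by (simp add: falling_ratio_def)
next
  case (Suc i)
  obtain j where j: "k = Suc (i + j)" using Suc.prems less_imp_Suc_add by (metis Suc_le_eq)
  have "Bernstein (k + q) j p * ((real q + real i + 1) * real k) = Bernstein (k + q) (Suc j) p * (real (Suc j) * real q)"
  proof -
    have "real (Suc j) * real ((k + q) choose Suc j) = real (k + q - j) * real ((k + q) choose j)"
      using binomial_absorb_comp [of "k + q" j] by (metis binomial_absorption of_nat_mult)
    moreover have "real (k + q - j) = real q + real i + 1" by (simp add: j)
    ultimately have ch: "real (Suc j) * real ((k + q) choose Suc j) = (real q + real i + 1) * real ((k + q) choose j)"
      by simp
    have pq: "(1 - p) * real k = p * real q" using assms by (simp add: p_def field_simps)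
    have "k + q - j = Suc (k + q - Suc j)" by (simp add: j)
    then have "Bernstein (k + q) j p * ((real q + real i + 1) * real k)
      = ((real q + real i + 1) * real ((k + q) choose j)) * p ^ j * (1 - p) ^ (k + q - Suc j) * ((1 - p) * real k)"
      by (simp add: Bernstein_def)
    also have "\<dots> = Bernstein (k + q) (Suc j) p * (real (Suc j) * real q)"
      unfolding ch [symmetric] pq by (simp add: Bernstein_def)
    finally show ?thesis .
  qed
  then have "Bernstein (k + q) j p = Bernstein (k + q) (Suc j) p * (real (Suc j) * real q) / ((real q + real i + 1) * real k)"
    using assms by (subst eq_divide_eq) auto
  also have "\<dots> = Bernstein (k + q) (Suc j) p * (real (Suc j) / real k * (real q / (real q + real i + 1)))"
    by simp
  also have "real q / (real q + real i + 1) = 1 / (1 + (real i + 1) * (1 / real q))"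
    using assms by (simp add: field_simps)
  also have "real (Suc j) / real k = 1 - real i / real k"
    by (simp add: j field_simps)
  finally have "Bernstein (k + q) j p
    = Bernstein (k + q) (Suc j) p * ((1 - real i / real k) * (1 / (1 + (real i + 1) * (1 / real q))))" .
  then have "Bernstein (k + q) j p / Bernstein (k + q) k p
    = Bernstein (k + q) (Suc j) p / Bernstein (k + q) k p
        * ((1 - real i / real k) * (1 / (1 + (real i + 1) * (1 / real q))))"
    by (simp only: times_divide_eq_left)
  moreover have "k - i = Suc j" "k - Suc i = j" by (auto simp: j)
  ultimately show ?case
    using Suc by (simp only: falling_ratio_Suc prod.lessThan_Suc mult_ac Suc_leD)
qed

text \<open>Each correction product is replaced by its quadratic bound in \<open>1 / q\<close>; the
  two moment identities then evaluate the coefficients.\<close>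

lemma binom_cdf_ratio_le_expansion:
  fixes k q :: nat
  defines "p \<equiv> real k / real (k + q)" and "x \<equiv> real k / real q"
    and "Q \<equiv> \<Sum>i\<le>k. falling_ratio k i"
  assumes k: "0 < k" and q: "0 < q"
  shows "binom_cdf (k + q) k p / Bernstein (k + q) k p \<le> Q * (1 - x / 2 + 3 * x\<^sup>2 / 4) - x\<^sup>2 / 2"
proof -
  define T where "T = (\<lambda>i::nat. real (i * (i + 1)) / 2)"
  define e where "e = 1 / real q"
  have x: "x = real k * e" by (simp add: x_def e_def)
  have "binom_cdf (k + q) k p = (\<Sum>i\<le>k. Bernstein (k + q) (k - i) p)"
    unfolding binom_cdf_def using sum.atLeastAtMost_rev [of "\<lambda>j. Bernstein (k + q) j p" 0 k]
    by (simp add: atLeast0AtMost)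
  then have "binom_cdf (k + q) k p / Bernstein (k + q) k p
      = (\<Sum>i\<le>k. falling_ratio k i * (\<Prod>m<i. 1 / (1 + (real m + 1) * e)))"
    unfolding e_def p_def using Bernstein_ratio [OF k q] by (simp add: sum_divide_distrib)
  also have "\<dots> \<le> (\<Sum>i\<le>k. falling_ratio k i * (1 - T i * e + (T i)\<^sup>2 * e\<^sup>2))"
    using prod_inverse_le [of e] falling_ratio_nonneg
    by (intro sum_mono mult_left_mono) (auto simp: T_def e_def)
  also have "\<dots> = Q * (1 - x / 2 + 3 * x\<^sup>2 / 4)
       - (\<Sum>i\<le>k. falling_ratio k i * (T i - real k / 2)) * e
       + (\<Sum>i\<le>k. falling_ratio k i * ((T i)\<^sup>2 - 3 * (real k)\<^sup>2 / 4)) * e\<^sup>2"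
    unfolding Q_def sum_distrib_right sum_subtractf [symmetric] sum.distrib [symmetric]
    by (intro sum.cong refl) (simp add: x field_simps power2_eq_square)
  also have "\<dots> = Q * (1 - x / 2 + 3 * x\<^sup>2 / 4) - x\<^sup>2 / 2"
    unfolding T_def sum_falling_ratio_first [OF k] sum_falling_ratio_second [OF k] falling_ratio_eq_0 [OF k]
    by (simp add: x_def e_def power_divide)
  finally show ?thesis .
qed

section \<open>Evaluation of the Poisson limit for \<open>k\<close> up to 24\<close>

text \<open>Nested form of the Poisson sum. The denominator \<open>c\<close> is separate from the
  index because it stays \<open>k\<close> while the index descends.\<close>

primrec horner :: "real \<Rightarrow> nat \<Rightarrow> real" where
  "horner c 0 = 1"
| "horner c (Suc j) = 1 + real (Suc j) / c * horner c j"

lemma horner_eq: "horner c j = (\<Sum>i\<le>j. \<Prod>m<i. (real j - real m) / c)"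
proof (induction j)
  case (Suc j)
  have "(\<Sum>i\<le>Suc j. \<Prod>m<i. (real (Suc j) - real m) / c)
      = 1 + (\<Sum>i\<le>j. real (Suc j) / c * (\<Prod>m<i. (real j - real m) / c))"
    unfolding sum.atMost_Suc_shift prod.lessThan_Suc_shift by simp
  with Suc show ?case by (simp add: sum_distrib_left)
qed simp

lemma sum_falling_ratio_eq_horner:
  assumes "0 < k"
  shows "(\<Sum>i\<le>k. falling_ratio k i) = horner (real k) k"
  using assms unfolding horner_eq falling_ratio_def by (simp add: diff_divide_distrib)

lemma horner_numeral:
  "horner c (numeral v) = 1 + numeral v / c * horner c (pred_numeral v)"
proof -
  have "horner c (numeral v) = 1 + real (Suc (pred_numeral v)) / c * horner c (pred_numeral v)"
    unfolding numeral_eq_Suc horner.simps ..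
  also have "real (Suc (pred_numeral v)) = numeral v"
    by (metis numeral_eq_Suc of_nat_numeral)
  finally show ?thesis .
qed

text \<open>The second inequality is an equality for \<open>k = 12\<close>, which is where the constant comes from.\<close>

lemma horner_bound:
  assumes "1 \<le> k" "k \<le> 24"
  shows "horner (real k) k \<le> 7 \<and> (2 * horner (real k) k / (180451625 / 143327232) - 1)\<^sup>2 \<le> 1 + 4 * real k"
proof -
  have "k \<in> insert 1 {2..<25}" using assms unfolding insert_iff atLeastLessThan_iff by arith
  also have "insert 1 {2..<25}
      = {1,2,3,4,5,6,7,8,9,10,11,12,13,14,15,16,17,18,19,20,21,22,23,24::nat}"
    unfolding set_upt [symmetric] by (simp del: set_upt)
  finally show ?thesis
    by (elim insertE emptyE) (simp_all add: horner_numeral power2_eq_square)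
qed

section \<open>The three ranges of the parameters\<close>

lemma cdf_ratio_less_ge_half:
  fixes k q :: nat
  defines "p \<equiv> real k / real (k + q)"
  assumes k: "0 < k" and q: "0 < q" "q \<le> k"
  shows "binom_cdf (k + q) k p / Bernstein (k + q) k p
    < sqrt (pi / 2) * (1 / 2 + sqrt (real k * (1 - p) + 1 / 4))"
proof -
  define \<sigma> where "\<sigma> = sqrt (real k * (1 - p))"
  have p: "1 / 2 \<le> p" "p < 1" using k q by (auto simp: p_def field_simps)
  have "real k * (1 - p) = real q * p" using k by (simp add: p_def field_simps)
  also have "1 * (1 / 2) \<le> real q * p" using p q by (intro mult_mono) auto
  finally have \<sigma>: "0 < \<sigma>" "\<sigma>\<^sup>2 = real k * (1 - p)" "1 / 2 \<le> \<sigma>\<^sup>2"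
    by (auto simp: \<sigma>_def)
  have "binom_cdf (k + q) k p / Bernstein (k + q) k p \<le> sqrt (pi / 2) * (\<sigma> + 1 / 8 / \<sigma>) + (2 - p) / 3"
    by (rule binom_cdf_ratio_le) (use k q p inverse_Psi_bound_ge_half [of p] in \<open>auto simp: p_def \<sigma>_def\<close>)
  also have "\<dots> < sqrt (pi / 2) * (1 / 2 + sqrt (\<sigma>\<^sup>2 + 1 / 4))"
  proof (rule bound_ge_half)
    show "6 / 5 \<le> sqrt (pi / 2)"
      using pi_bounds by (intro real_le_rsqrt) (simp add: power2_eq_square)
  qed (use \<sigma> p in auto)
  finally show ?thesis by (simp add: \<sigma>)
qed

lemma cdf_ratio_less_lt_half:
  fixes k q :: nat
  defines "p \<equiv> real k / real (k + q)"
  assumes k: "0 < k" "k < q" and large: "25 \<le> k \<or> 0.04 \<le> p"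
  shows "binom_cdf (k + q) k p / Bernstein (k + q) k p
    < 180451625 / 143327232 * (1 / 2 + sqrt (real k * (1 - p) + 1 / 4))"
proof -
  define \<sigma> where "\<sigma> = sqrt (real k * (1 - p))"
  have p: "0 < p" "p < 1 / 2" using k by (auto simp: p_def field_simps)
  have "1 * (1 / 2) \<le> real k * (1 - p)" using p k by (intro mult_mono) auto
  then have \<sigma>: "0 < \<sigma>" "\<sigma>\<^sup>2 = real k * (1 - p)" "1 / 2 \<le> \<sigma>\<^sup>2"
    by (auto simp: \<sigma>_def)
  have large': "0.04 \<le> p \<or> 4.89 \<le> \<sigma>"
  proof (rule disjCI)
    assume "\<not> 4.89 \<le> \<sigma>"
    show "0.04 \<le> p"
    proof (rule ccontr)
      assume "\<not> 0.04 \<le> p"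
      \<comment> \<open>\<open>25 * 0.96 = 24\<close> exceeds \<open>4.89^2\<close>, which fixes the
        thresholds 25, 0.04 and 4.89.\<close>
      then have "25 * 0.96 \<le> real k * (1 - p)" using large by (intro mult_mono) auto
      then have "4.89 \<le> \<sigma>" unfolding \<sigma>_def by (intro real_le_rsqrt) (simp add: power2_eq_square)
      then show False using \<open>\<not> 4.89 \<le> \<sigma>\<close> by simp
    qed
  qed
  have "binom_cdf (k + q) k p / Bernstein (k + q) k p \<le> sqrt (pi / 2) * (\<sigma> + 1 / 12 / \<sigma>) + (2 - p) / 3"
    by (rule binom_cdf_ratio_le) (use k p inverse_Psi_bound_le_half [of p] in \<open>auto simp: p_def \<sigma>_def\<close>)
  also have "\<dots> < 1.25901 * (1 / 2 + sqrt (\<sigma>\<^sup>2 + 1 / 4))"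
  proof (rule bound_lt_half)
    show "sqrt (pi / 2) \<le> 1.2534"
      using pi_bounds by (intro real_le_lsqrt) (simp_all add: power2_eq_square)
  qed (use \<sigma> p large' in auto)
  also have "\<dots> \<le> 180451625 / 143327232 * (1 / 2 + sqrt (\<sigma>\<^sup>2 + 1 / 4))"
    by (intro mult_right_mono add_nonneg_nonneg) simp_all
  finally show ?thesis by (simp add: \<sigma>)
qed

text \<open>Multiplying the Poisson inequality \<open>Q <= C/2 (1 + sqrt (1 + 4 k))\<close> by
  \<open>s\<close> leaves the slack \<open>C/2 (1 - s)\<close>, since the summand 1/2 of
  \<open>L\<close> does not shrink with \<open>s\<close>. This slack absorbs the second-order error
  of the expansion.\<close>

lemma cdf_ratio_less_small:
  fixes k q :: nat
  defines "p \<equiv> real k / real (k + q)"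
  assumes k: "1 \<le> k" "k \<le> 24" and q: "0 < q" and small: "p < 0.04"
  shows "binom_cdf (k + q) k p / Bernstein (k + q) k p
    < 180451625 / 143327232 * (1 / 2 + sqrt (real k * (1 - p) + 1 / 4))"
proof -
  define C :: real where "C = 180451625 / 143327232"
  define Q where "Q = (\<Sum>i\<le>k. falling_ratio k i)"
  define x where "x = real k / real q"
  define s where "s = sqrt (1 - p)"
  have Q: "Q \<le> 7" "(2 * Q / C - 1)\<^sup>2 \<le> 1 + 4 * real k"
    using horner_bound [OF k] k by (auto simp: Q_def C_def sum_falling_ratio_eq_horner)
  have Q0: "0 \<le> Q" unfolding Q_def by (intro sum_nonneg falling_ratio_nonneg) simp
  \<comment> \<open>\<open>x = p / (1 - p)\<close>, so \<open>p < 0.04\<close> gives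
    \<open>x < 1/24\<close>.\<close>
  have x: "0 < x" "x \<le> 1 / 24" using k q small by (auto simp: x_def p_def field_simps)
  have p: "0 < p" "1 - p = 1 / (1 + x)" using k q by (auto simp: x_def p_def field_simps)
  \<comment> \<open>\<open>s = (1 + x)^(-1/2)\<close> lies between its Taylor polynomials of degrees
    1 and 2.\<close>
  have s_lower: "1 - x / 2 \<le> s"
    unfolding s_def
  proof (rule real_le_rsqrt)
    have "x ^ 3 \<le> 3 * x\<^sup>2" using x mult_right_mono [of x 3 "x\<^sup>2"] by (simp add: power2_eq_square power3_eq_cube)
    then have "(1 - x / 2)\<^sup>2 * (1 + x) \<le> 1" by (simp add: power2_eq_square power3_eq_cube field_simps)
    then show "(1 - x / 2)\<^sup>2 \<le> 1 - p" using x by (simp add: p le_divide_eq)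
  qed
  have s_upper: "s \<le> 1 - x / 2 + 3 * x\<^sup>2 / 8"
    unfolding s_def
  proof (rule real_le_lsqrt)
    have "0 \<le> x ^ 3 * (40 - 15 * x + 9 * x\<^sup>2) / 64" using x by simp
    also have "\<dots> = (1 - x / 2 + 3 * x\<^sup>2 / 8)\<^sup>2 * (1 + x) - 1"
      by (simp add: power2_eq_square power3_eq_cube field_simps)
    finally show "1 - p \<le> (1 - x / 2 + 3 * x\<^sup>2 / 8)\<^sup>2" using x by (simp add: p divide_le_eq)
    show "0 \<le> 1 - x / 2 + 3 * x\<^sup>2 / 8" using x by (intro add_nonneg_nonneg) auto
  qed
  have s: "0 < s" "s < 1" "s\<^sup>2 = 1 - p" using p(1) small by (auto simp: s_def)
  have C: "0 < C" "1.25 \<le> C" by (auto simp: C_def)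
  have "binom_cdf (k + q) k p / Bernstein (k + q) k p \<le> Q * (1 - x / 2 + 3 * x\<^sup>2 / 4) - x\<^sup>2 / 2"
    unfolding p_def Q_def x_def using k q by (intro binom_cdf_ratio_le_expansion) auto
  also have "\<dots> \<le> s * Q + C / 2 * (1 - s)"
  proof -
    \<comment> \<open>The slack is at least \<open>5 x / 16\<close> up to order \<open>x^2\<close>,
      and \<open>x <= 1/24\<close> and \<open>Q <= 7\<close> make it exceed all terms of order
      \<open>x^2\<close>.\<close>
    have x2: "x\<^sup>2 \<le> x / 24" using x mult_left_mono [of x "1/24" x] by (simp add: power2_eq_square)
    have "Q * (1 - x / 2) \<le> Q * s" using s_lower Q0 by (rule mult_left_mono)
    moreover have "Q * (3 * x\<^sup>2 / 4) \<le> 7 * (3 * x\<^sup>2 / 4)" using Q by (intro mult_right_mono) auto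
    moreover have "1.25 / 2 * (x / 2 - 3 * x\<^sup>2 / 8) \<le> C / 2 * (1 - s)"
      using s_upper C s x x2 by (intro mult_mono) auto
    moreover have "Q * (1 - x / 2 + 3 * x\<^sup>2 / 4) = Q * (1 - x / 2) + Q * (3 * x\<^sup>2 / 4)"
      by (simp add: algebra_simps)
    moreover have "0 \<le> 1.25 / 2 * (x / 2 - 3 * x\<^sup>2 / 8) - 7 * (3 * x\<^sup>2 / 4) + x\<^sup>2 / 2"
      using x x2 by simp
    ultimately show ?thesis by (simp only: mult.commute [of s Q])
  qed
  also have "\<dots> \<le> C * (1 / 2 + s * sqrt (1 + 4 * real k) / 2)"
  proof -
    have "2 * Q / C - 1 \<le> sqrt (1 + 4 * real k)" by (rule real_le_rsqrt) fact
    then have "Q \<le> C * (1 + sqrt (1 + 4 * real k)) / 2" using C by (simp add: field_simps)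
    from mult_left_mono [OF this, of s] s show ?thesis by (simp add: field_simps)
  qed
  \<comment> \<open>Strictness comes from \<open>(1 - p) / 4 < 1 / 4\<close>; the Poisson inequality
    is an equality at \<open>k = 12\<close>.\<close>
  also have "\<dots> < C * (1 / 2 + sqrt (real k * (1 - p) + 1 / 4))"
  proof -
    have "s * sqrt (1 + 4 * real k) = sqrt ((1 - p) * (1 + 4 * real k))"
      by (simp add: s_def real_sqrt_mult)
    also have "\<dots> < sqrt (4 * (real k * (1 - p) + 1 / 4))"
      using p(1) by (intro real_sqrt_less_mono) (simp add: algebra_simps)
    also have "\<dots> = 2 * sqrt (real k * (1 - p) + 1 / 4)"
      by (simp only: real_sqrt_mult real_sqrt_four)
    finally show ?thesis using C by simp
  qed
  finally show ?thesis by (simp add: C_def)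
qed

theorem lemma6p3:
  fixes k n :: nat
  assumes "1 \<le> k" and "k \<le> n - 1"
  shows "binom_cdf n k (real k / real n) / Bernstein n k (real k / real n)
           < 180451625 / 143327232 * binom_L n k (real k / real n)
       \<and> (n \<le> 2 * k \<longrightarrow>
           binom_cdf n k (real k / real n) / Bernstein n k (real k / real n)
             < sqrt (pi / 2) * binom_L n k (real k / real n))"
proof -
  define q where "q = n - k"
  define p where "p = real k / real n"
  have n: "n = k + q" "0 < q" "0 < k" using assms by (auto simp: q_def)
  have "p \<le> 1" using n by (simp add: p_def)
  have L: "binom_L n k p = 1 / 2 + sqrt (real k * (1 - p) + 1 / 4)" (is "_ = _ + ?r")
  proof -
    have "p * real n = real k" using n by (simp add: p_def)
    moreover have "1 + 4 * (1 - p) * real k = 4 * (real k * (1 - p) + 1 / 4)"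
      by (simp add: algebra_simps)
    then have "sqrt (1 + 4 * (1 - p) * real k) = 2 * ?r"
      by (simp only: real_sqrt_mult real_sqrt_four)
    ultimately show ?thesis by (simp add: binom_L_def)
  qed
  have "0 \<le> ?r" using \<open>p \<le> 1\<close> by simp
  have half: "binom_cdf n k p / Bernstein n k p < sqrt (pi / 2) * binom_L n k p" if "q \<le> k"
    using cdf_ratio_less_ge_half [OF n(3,2) that] unfolding L by (simp add: p_def n)
  have "binom_cdf n k p / Bernstein n k p < 180451625 / 143327232 * binom_L n k p"
  proof (cases "q \<le> k")
    case True
    note half [OF True]
    also have "sqrt (pi / 2) * binom_L n k p \<le> 180451625 / 143327232 * binom_L n k p"
      unfolding L
    proof (rule mult_right_mono)
      show "sqrt (pi / 2) \<le> 180451625 / 143327232"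
        using pi_bounds by (intro real_le_lsqrt) (simp_all add: power2_eq_square)
    qed (use \<open>0 \<le> ?r\<close> in simp)
    finally show ?thesis .
  next
    case False
    show ?thesis
    proof (cases "25 \<le> k \<or> 0.04 \<le> p")
      case True
      with cdf_ratio_less_lt_half [of k q] n False show ?thesis
        unfolding L by (simp add: p_def)
    next
      case not_large: False
      with cdf_ratio_less_small [of k q] n show ?thesis
        unfolding L by (simp add: p_def)
    qed
  qed
  moreover have "q \<le> k" if "n \<le> 2 * k" using that n by simp
  ultimately show ?thesis using half by (simp add: p_def)
qed

end
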